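(* Let $D=\{1,\dots,d\}$, let $F:\mathbb{R}^d\to\mathbb{R}$ be a model and let $b\in\mathbb{R}^d$ be a baseline. If $F$ is represented by its Taylor series expanded around $b$ for an instance $x_0\in\mathbb{R}^d$, then for $S\subseteq D$ the baseline fANOVA effect $f^{(b)}_S$ at $x_0$ is given by the generic (Taylor) effects $$f^{(b)}_S(x_0)=\begin{cases}F(b), & \text{if } S=\emptyset \quad(\text{baseline}),\\ \psi(i), & \text{if } S=\{i\}\quad(\text{main effect}),\\ J(S), & \text{else}\quad(\text{interaction effect}),\end{cases}$$ where $\psi(i)$ and $J(S)$ are the generic independent effect and the generic interaction effect at $x_0$ with respect to $b$.
   Context: Notation: $-S:=D\setminus S$; $(x_S,b_{-S})$ is the point with coordinates $x_i$ for $i\in S$ and $b_i$ for $i\notin S$. Baseline fANOVA (b-fANOVA): the value functions are $F^{(b)}_S(x):=F(x_S,b_{-S})$ for $S\subseteq D$, and the effects are defined recursively by $f^{(b)}_S(x):=F^{(b)}_S(x)-\sum_{T\subsetneq S}f^{(b)}_T(x)$. Taylor series: the infinite Taylor expansion of $F$ at the baseline $b$ is $$F(x)=\sum_{\kappa\in\mathbb{N}_0^d}\frac{1}{\kappa_1!\cdots\kappa_d!}\,\frac{\partial^{\kappa_1+\dots+\kappa_d}F(b)}{\partial x_1^{\kappa_1}\cdots\partial x_d^{\kappa_d}}\,(x_1-b_1)^{\kappa_1}\cdots(x_d-b_d)^{\kappa_d},$$ where $\kappa=[\kappa_1,\dots,\kappa_d]$ records the order of the partial derivative in each feature (with the convention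 $0^0=1$). Taylor effects: write $I(\kappa)$ for the summand of this series belonging to $\kappa$, evaluated at $x=x_0$, i.e. $$I(\kappa):=\frac{1}{\kappa_1!\cdots\kappa_d!}\,\frac{\partial^{\kappa_1+\dots+\kappa_d}F(b)}{\partial x_1^{\kappa_1}\cdots\partial x_d^{\kappa_d}}\,\prod_{i=1}^d(x_{0,i}-b_i)^{\kappa_i}.$$ For nonempty $S\subseteq D$ let $\Omega_S:=\{\kappa\in\mathbb{N}_0^d:\kappa_i>0\ \forall i\in S,\ \kappa_i=0\ \forall i\notin S\}$. The generic independent effect of $i\in D$ is $\psi(i):=\sum_{\kappa\in\Omega_{\{i\}}}I(\kappa)$, and the generic interaction effect of $S\subseteq D$ with $|S|>1$ is $J(S):=\sum_{\kappa\in\Omega_S}I(\kappa)$.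
   Formalization: The Taylor series around b is assumed to represent F, with unconditional convergence, at all points (x_{0,T}, b_{-T}) for T ⊆ D, not only at x_0 (for x_0 alone the claim is false), and F is assumed smooth near b. *)

theory Defs
  imports "HOL-Analysis.Analysis"
begin

text \<open>
  The index set \<open>D = {1, ..., d}\<close> is rendered as a type \<open>'n\<close> of class \<open>finite\<close>; points of
  \<open>d\<close>-space are of type \<open>real ^ 'n\<close> and multi-indices are functions \<open>'n \<Rightarrow> nat\<close>.  Where the
  order of the coordinates matters, \<open>'n\<close> is moreover required to be of class \<open>linorder\<close>.
\<close>

text \<open>The notation \<open>real ^ 'n\<close> itself would force the sort of every occurrence of \<open>'n\<close>.\<close>
type_synonym 'n point = "(real, 'n) vec"

definition merge_point :: "'n::finite set \<Rightarrow> 'n point \<Rightarrow> 'n point \<Rightarrow> 'n point" where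
  "merge_point S x b = (\<chi> i. if i \<in> S then x $ i else b $ i)"

definition baseline_value ::
    "('n::finite point \<Rightarrow> real) \<Rightarrow> 'n point \<Rightarrow> 'n set \<Rightarrow> 'n point \<Rightarrow> real" where
  "baseline_value F b S x = F (merge_point S x b)"

function bfanova_effect ::
    "('n::finite point \<Rightarrow> real) \<Rightarrow> 'n point \<Rightarrow> 'n set \<Rightarrow> 'n point \<Rightarrow> real" where
  "bfanova_effect F b S x =
     baseline_value F b S x - (\<Sum>T\<in>{T. T \<subset> S}. bfanova_effect F b T x)"
  by auto
termination
  by (relation "Wellfounded.measure (\<lambda>(F, b, S, x). card S)") (auto intro: psubset_card_mono)

text \<open>The defining equation loops as a rewrite rule.\<close>
declare bfanova_effect.simps [simp del]

definition partial_deriv ::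
    "'n::finite \<Rightarrow> ('n point \<Rightarrow> real) \<Rightarrow> 'n point \<Rightarrow> real" where
  "partial_deriv i F x = deriv (\<lambda>t. F (x + t *\<^sub>R axis i 1)) 0"

text \<open>The head of the list is the direction of the outermost derivative.\<close>
definition iterated_partial ::
    "'n::finite list \<Rightarrow> ('n point \<Rightarrow> real) \<Rightarrow> 'n point \<Rightarrow> real" where
  "iterated_partial is F = foldr partial_deriv is F"

text \<open>
  For functions that are not smooth, \<^const>\<open>deriv\<close> may return arbitrary values.  The following
  predicate says that \<open>F\<close> is of class \<open>C\<close>-infinity on some neighbourhood of \<open>b\<close>: all partial
  derivatives of all orders, taken in any order of the coordinates, exist and are continuous.
\<close>
definition smooth_near :: "('n::finite point \<Rightarrow> real) \<Rightarrow> 'n point \<Rightarrow> bool" where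
  "smooth_near F b \<longleftrightarrow>
     (\<exists>U. open U \<and> b \<in> U \<and>
        (\<forall>is. continuous_on U (iterated_partial is F) \<and>
           (\<forall>x\<in>U. \<forall>i. (\<lambda>t::real. iterated_partial is F (x + t *\<^sub>R axis i 1)) differentiable at 0)))"

text \<open>
  The derivative belonging to a multi-index, with the coordinates in increasing order from the
  outermost to the innermost derivative.  For functions satisfying \<^const>\<open>smooth_near\<close> the order
  is immaterial at the base point.
\<close>
definition mixed_partial ::
    "('n::{finite,linorder} \<Rightarrow> nat) \<Rightarrow> ('n point \<Rightarrow> real) \<Rightarrow> 'n point \<Rightarrow> real" where
  "mixed_partial \<kappa> F =
     iterated_partial (concat (map (\<lambda>i. replicate (\<kappa> i) i) (sorted_list_of_set UNIV))) F"

definition taylor_term ::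
    "('n::{finite,linorder} point \<Rightarrow> real) \<Rightarrow> 'n point \<Rightarrow> 'n point \<Rightarrow> ('n \<Rightarrow> nat) \<Rightarrow> real" where
  "taylor_term F b x \<kappa> =
     1 / (\<Prod>i\<in>UNIV. fact (\<kappa> i)) * mixed_partial \<kappa> F b * (\<Prod>i\<in>UNIV. (x $ i - b $ i) ^ \<kappa> i)"

text \<open>
  The multi-indices carry no canonical order of summation, so convergence of the Taylor series
  is unconditional convergence.  Validity of the expansion at a single point \<open>x0\<close> does not
  determine \<open>F\<close> at the points \<^term>\<open>merge_point T x0 b\<close> entering the fANOVA effects; a statement
  about these effects needs the expansion at all of those points.
\<close>
definition taylor_represented_at ::
    "('n::{finite,linorder} point \<Rightarrow> real) \<Rightarrow> 'n point \<Rightarrow> 'n point \<Rightarrow> bool" where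
  "taylor_represented_at F b x \<longleftrightarrow> (taylor_term F b x has_sum F x) UNIV"

definition Omega :: "'n set \<Rightarrow> ('n \<Rightarrow> nat) set" where
  "Omega S = {\<kappa>. (\<forall>i\<in>S. \<kappa> i > 0) \<and> (\<forall>i. i \<notin> S \<longrightarrow> \<kappa> i = 0)}"

text \<open>
  If the Taylor series at \<open>x0\<close> converges unconditionally, so do the following two subseries;
  then \<^const>\<open>infsum\<close> returns their sums and not its default value.
\<close>
definition generic_independent_effect ::
    "('n::{finite,linorder} point \<Rightarrow> real) \<Rightarrow> 'n point \<Rightarrow> 'n point \<Rightarrow> 'n \<Rightarrow> real" where
  "generic_independent_effect F b x0 i = infsum (taylor_term F b x0) (Omega {i})"

definition generic_interaction_effect ::
    "('n::{finite,linorder} point \<Rightarrow> real) \<Rightarrow> 'n point \<Rightarrow> 'n point \<Rightarrow> 'n set \<Rightarrow> real" where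
  "generic_interaction_effect F b x0 S = infsum (taylor_term F b x0) (Omega S)"

end

theory Submission imports Defs begin

text \<open>
  At the point \<open>(x\<^sub>T, b\<^sub>-\<^sub>T)\<close> a Taylor monomial vanishes as soon as its multi-index has support
  outside \<open>T\<close>, and is otherwise the same as at \<open>x\<close>.  Hence the value function of \<open>T\<close> is the sum,
  over all \<open>U \<subseteq> T\<close>, of the Taylor subseries over \<open>Omega U\<close>.  The fANOVA effects are the Moebius
  inverse of the value functions, so they are exactly these subseries.
\<close>

lemma taylor_term_merge_point:
  "taylor_term F b (merge_point T x b) \<kappa> =
     (if {i. \<kappa> i > 0} \<subseteq> T then taylor_term F b x \<kappa> else 0)"
proof (cases "{i. \<kappa> i > 0} \<subseteq> T")
  case True
  then have "\<kappa> i = 0" if "i \<notin> T" for i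
    using that by auto
  \<comment> \<open>Outside \<open>T\<close> the two bases may differ, but both exponents are 0, and
    \<open>0 ^ 0 = 1\<close>.\<close>
  then have "(\<Prod>i\<in>UNIV. (merge_point T x b $ i - b $ i) ^ \<kappa> i) = (\<Prod>i\<in>UNIV. (x $ i - b $ i) ^ \<kappa> i)"
    by (intro prod.cong) (auto simp: merge_point_def)
  then show ?thesis
    using True by (simp add: taylor_term_def)
next
  case False
  then obtain i where "\<kappa> i > 0" "i \<notin> T"
    by auto
  then have "(merge_point T x b $ i - b $ i) ^ \<kappa> i = 0"
    by (simp add: merge_point_def)
  then have "(\<Prod>i\<in>UNIV. (merge_point T x b $ i - b $ i) ^ \<kappa> i) = 0"
    by (intro prod_zero) auto
  then show ?thesis
    using False by (simp add: taylor_term_def)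
qed

text \<open>As fibres of the support map, these sets are pairwise disjoint, and those with
  \<open>U \<subseteq> T\<close> cover exactly the multi-indices supported in
  \<open>T\<close>.\<close>

lemma Omega_eq_support: "Omega S = {\<kappa>. {i. \<kappa> i > 0} = S}"
  by (auto simp: Omega_def)

lemma baseline_value_eq_sum_Omega:
  assumes taylor: "\<And>T. taylor_represented_at F b (merge_point T x b)"
  shows "baseline_value F b T x = (\<Sum>U\<in>Pow T. infsum (taylor_term F b x) (Omega U))"
proof -
  have "merge_point UNIV x b = x"
    by (simp add: merge_point_def vec_eq_iff)
  \<comment> \<open>The expansion at \<open>x\<close> itself provides the summability that splitting
    the series requires.\<close>
  with taylor[of UNIV] have "taylor_term F b x summable_on UNIV"
    unfolding taylor_represented_at_def by (metis has_sum_imp_summable)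
  then have summable: "taylor_term F b x summable_on Omega U" for U
    by (rule summable_on_subset_banach) simp
  have "baseline_value F b T x = infsum (taylor_term F b (merge_point T x b)) UNIV"
    using taylor[of T] by (simp add: taylor_represented_at_def baseline_value_def infsumI)
  also have "\<dots> = infsum (taylor_term F b x) (\<Union>U\<in>Pow T. Omega U)"
    by (intro infsum_cong_neutral) (auto simp: taylor_term_merge_point Omega_eq_support)
  also have "\<dots> = (\<Sum>U\<in>Pow T. infsum (taylor_term F b x) (Omega U))"
    by (intro sum_infsum[symmetric] summable) (auto simp: Omega_eq_support)
  finally show ?thesis .
qed

text \<open>Induction along strict inclusion takes the place of an explicit Moebius inversion: the
  subseries satisfy the recursion that defines the effects.\<close>

lemma bfanova_effect_eq_infsum_Omega:
  assumes taylor: "\<And>T. taylor_represented_at F b (merge_point T x b)"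
  shows "bfanova_effect F b S x = infsum (taylor_term F b x) (Omega S)"
proof -
  have "finite S"
    by simp
  then show ?thesis
  proof (induction S rule: finite_psubset_induct)
    case (psubset S)
    have "Pow S = insert S {T. T \<subset> S}"
      by auto
    then have "baseline_value F b S x = infsum (taylor_term F b x) (Omega S) +
        (\<Sum>T\<in>{T. T \<subset> S}. infsum (taylor_term F b x) (Omega T))"
      by (simp add: baseline_value_eq_sum_Omega[OF taylor])
    then show ?case
      by (subst bfanova_effect.simps) (simp add: psubset.IH)
  qed
qed

theorem theorem1:
  fixes F :: "'n::{finite,linorder} point \<Rightarrow> real"
    and b x0 :: "'n point"
    and S :: "'n set"
  assumes smooth: "smooth_near F b"
    and taylor: "\<And>T. taylor_represented_at F b (merge_point T x0 b)"
  shows "(S = {} \<longrightarrow> bfanova_effect F b S x0 = F b) \<and>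
         (\<forall>i. S = {i} \<longrightarrow> bfanova_effect F b S x0 = generic_independent_effect F b x0 i) \<and>
         (card S > 1 \<longrightarrow> bfanova_effect F b S x0 = generic_interaction_effect F b x0 S)"
proof -
  have "merge_point {} x0 b = b"
    by (simp add: merge_point_def vec_eq_iff)
  \<comment> \<open>The empty set has no proper subsets, so the recursion leaves only the value
    function, taken at \<open>b\<close>.\<close>
  then have "bfanova_effect F b {} x0 = F b"
    by (simp add: bfanova_effect.simps[of F b "{}" x0] baseline_value_def)
  then show ?thesis
    by (auto simp: bfanova_effect_eq_infsum_Omega[OF taylor]
        generic_independent_effect_def generic_interaction_effect_def)
qed

end
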